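(* For all integers $n,p\ge0$, \[ \sum_{k=0}^{\infty}\sum_{m=0}^{\infty}\frac{(x+k)_{n,\lambda}}{k!}\frac{(-1)^{m}}{m!\binom{m+k+p}{p}}=\sum_{m=0}^{n}\sum_{k=0}^{m}\frac{\binom{n}{m}}{\binom{p+k}{k}}S_{2,\lambda}(m,k)\,(x)_{n-m,\lambda}. \]
   Context: Let $\lambda\in\mathbb{R}$. Set $(x)_{0,\lambda}=1$, $(x)_{n,\lambda}=x(x-\lambda)\cdots(x-(n-1)\lambda)$ for $n\ge1$; $(y)_0=1$, $(y)_n=y(y-1)\cdots(y-n+1)$. The degenerate Stirling numbers of the second kind $S_{2,\lambda}(n,k)$ are defined by $(y)_{n,\lambda}=\sum_{k=0}^n S_{2,\lambda}(n,k)(y)_k$ for all $y$. *)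

theory Defs
  imports Complex_Main
begin

definition degen_ffact :: "real \<Rightarrow> real \<Rightarrow> nat \<Rightarrow> real" where
  "degen_ffact l x n = (\<Prod>i<n. x - real i * l)"

definition ffact :: "real \<Rightarrow> nat \<Rightarrow> real" where
  "ffact y n = (\<Prod>i<n. y - real i)"

text \<open>The condition \<open>c k = 0\<close> for \<open>k > n\<close> only makes the coefficient sequence unique as a
  function on all of \<open>nat\<close>; unique existence is lemma \<open>degen_Stirling2_ex1\<close> below.\<close>

definition degen_Stirling2 :: "real \<Rightarrow> nat \<Rightarrow> nat \<Rightarrow> real" where
  "degen_Stirling2 l n =
     (THE c. (\<forall>k>n. c k = 0) \<and> (\<forall>y. degen_ffact l y n = (\<Sum>k\<le>n. c k * ffact y k)))"

lemma ffact_expansion_exists: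
  "\<exists>c. (\<forall>k>n. c k = 0) \<and> (\<forall>y. degen_ffact l y n = (\<Sum>k\<le>n. c k * ffact y k))"
proof (induction n)
  case 0
  show ?case
    by (rule exI[of _ "\<lambda>k. if k = 0 then 1 else 0"]) (simp add: degen_ffact_def ffact_def)
next
  case (Suc n)
  then obtain c where c0: "\<forall>k>n. c k = 0"
    and c: "\<And>y. degen_ffact l y n = (\<Sum>k\<le>n. c k * ffact y k)" by blast
  define d where "d = (\<lambda>k. (case k of 0 \<Rightarrow> 0 | Suc j \<Rightarrow> c j) + (real k - real n * l) * c k)"
  have step: "(y - real n * l) * ffact y k = ffact y (Suc k) + (real k - real n * l) * ffact y k"
    for y k by (simp add: ffact_def algebra_simps)
  have "degen_ffact l y (Suc n) = (\<Sum>k\<le>Suc n. d k * ffact y k)" for y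
  proof -
    have "degen_ffact l y (Suc n) = (y - real n * l) * degen_ffact l y n"
      by (simp add: degen_ffact_def)
    also have "\<dots> = (\<Sum>k\<le>n. c k * ((y - real n * l) * ffact y k))"
      by (simp add: c sum_distrib_left mult_ac)
    also have "\<dots> = (\<Sum>k\<le>n. c k * ffact y (Suc k)) + (\<Sum>k\<le>n. (real k - real n * l) * c k * ffact y k)"
      by (simp only: step distrib_left sum.distrib mult.assoc) (simp only: mult_ac)
    also have "(\<Sum>k\<le>n. c k * ffact y (Suc k))
        = (\<Sum>k\<le>Suc n. (case k of 0 \<Rightarrow> 0 | Suc j \<Rightarrow> c j) * ffact y k)"
      by (subst sum.atMost_Suc_shift) simp
    also have "(\<Sum>k\<le>n. (real k - real n * l) * c k * ffact y k)
        = (\<Sum>k\<le>Suc n. (real k - real n * l) * c k * ffact y k)"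
      using c0 by simp
    finally show ?thesis by (simp only: d_def distrib_right sum.distrib)
  qed
  moreover have "\<forall>k>Suc n. d k = 0" using c0 by (auto simp: d_def split: nat.split)
  ultimately show ?case by blast
qed

lemma ffact_coeffs_zero:
  assumes "\<And>y. (\<Sum>k\<le>n. c k * ffact y k) = 0" "k \<le> n"
  shows "c k = 0"
  using assms(2)
proof (induction k rule: less_induct)
  case (less k)
  have "ffact (real k) j = 0" if "j > k" for j
    using that by (auto simp: ffact_def)
  then have "(\<Sum>j\<le>n. c j * ffact (real k) j) = (\<Sum>j\<in>{k}. c j * ffact (real k) j)"
    using less by (intro sum.mono_neutral_right) (auto simp: not_less neq_iff)
  then have "c k * ffact (real k) k = 0" using assms(1)[of "real k"] by simp
  moreover have "ffact (real k) k \<noteq> 0" by (auto simp: ffact_def)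
  ultimately show ?case by simp
qed

lemma degen_Stirling2_ex1:
  "\<exists>!c. (\<forall>k>n. c k = 0) \<and> (\<forall>y. degen_ffact l y n = (\<Sum>k\<le>n. c k * ffact y k))"
proof (rule ex_ex1I[OF ffact_expansion_exists])
  fix c d
  assume c: "(\<forall>k>n. c k = 0) \<and> (\<forall>y. degen_ffact l y n = (\<Sum>k\<le>n. c k * ffact y k))"
    and d: "(\<forall>k>n. d k = 0) \<and> (\<forall>y. degen_ffact l y n = (\<Sum>k\<le>n. d k * ffact y k))"
  have "(\<Sum>k\<le>n. (c k - d k) * ffact y k) = 0" for y
    using c d by (simp add: left_diff_distrib sum_subtractf)
  then have "c k - d k = 0" if "k \<le> n" for k
    using that by (rule ffact_coeffs_zero)
  then show "c = d" using c d by (metis eq_iff_diff_eq_0 ext not_le)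
qed

lemma degen_Stirling2_expansion:
  "degen_ffact l y n = (\<Sum>k\<le>n. degen_Stirling2 l n k * ffact y k)"
  using theI'[OF degen_Stirling2_ex1[of n l]] unfolding degen_Stirling2_def by blast

lemma degen_Stirling2_eq_0: "k > n \<Longrightarrow> degen_Stirling2 l n k = 0"
  using theI'[OF degen_Stirling2_ex1[of n l]] unfolding degen_Stirling2_def by blast

end

theory Submission
  imports Defs "HOL-Analysis.Infinite_Sum" "HOL-Analysis.Elementary_Metric_Spaces"
begin

text \<open>By the binomial theorem for \<open>degen_ffact\<close> and the defining expansion of
  \<open>degen_Stirling2\<close>, the polynomial \<open>degen_ffact l (x + k) n\<close> is a linear combination of the
  falling factorials \<open>ffact k j\<close>, so it suffices to treat these. There the double series converges
  absolutely and may be summed along the diagonals \<open>k + m = N\<close>, on which the binomial weight is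
  constant. The diagonal sum of \<open>ffact k j / k!\<close> against \<open>(-1)^m / m!\<close> is the coefficient of
  \<open>t^N\<close> in \<open>t^j exp t * exp (- t) = t^j\<close>, so only \<open>N = j\<close> contributes.\<close>

text \<open>Each factor is \<open>x - i * l = (- l) * (- x / l + i)\<close>. This rescaling makes
  the Vandermonde identity for \<open>pochhammer\<close> available.\<close>

lemma degen_ffact_pochhammer:
  assumes "l \<noteq> 0"
  shows "degen_ffact l x n = (- l) ^ n * pochhammer (- x / l) n"
proof -
  have "(\<Prod>i<n. x - real i * l) = (\<Prod>i<n. (- l) * (- x / l + real i))"
    using assms by (intro prod.cong) (auto simp: field_simps)
  then show ?thesis
    unfolding degen_ffact_def pochhammer_prod prod.distrib by (simp add: lessThan_atLeast0)
qed

text \<open>For \<open>l = 0\<close> this is the ordinary binomial theorem. Otherwise it is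
  Vandermonde for \<open>pochhammer\<close>, with the factor \<open>(- l) ^ n\<close> split between
  the two arguments.\<close>

lemma degen_ffact_add:
  "degen_ffact l (x + y) n =
     (\<Sum>m\<le>n. real (n choose m) * degen_ffact l y m * degen_ffact l x (n - m))"
proof (cases "l = 0")
  case True
  then show ?thesis
    by (simp add: degen_ffact_def binomial_ring[of y x n] add.commute[of x y])
next
  case False
  have "- (x + y) / l = - y / l + - x / l"
    by (simp add: add_divide_distrib diff_divide_distrib)
  then have "degen_ffact l (x + y) n = (- l) ^ n * pochhammer (- y / l + - x / l) n"
    using False by (simp only: degen_ffact_pochhammer not_False_eq_True)
  also have "\<dots> = (\<Sum>m\<le>n. (- l) ^ n * (real (n choose m) * pochhammer (- y / l) m *
      pochhammer (- x / l) (n - m)))"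
    by (simp only: pochhammer_binomial_sum sum_distrib_left)
  also have "\<dots> = (\<Sum>m\<le>n. real (n choose m) * degen_ffact l y m * degen_ffact l x (n - m))"
  proof (rule sum.cong)
    fix m assume "m \<in> {..n}"
    then have "(- l) ^ n = (- l) ^ m * (- l) ^ (n - m)"
      by (simp flip: power_add)
    then show "(- l) ^ n * (real (n choose m) * pochhammer (- y / l) m * pochhammer (- x / l) (n - m))
        = real (n choose m) * degen_ffact l y m * degen_ffact l x (n - m)"
      using False by (simp only: degen_ffact_pochhammer mult_ac not_False_eq_True)
  qed simp
  finally show ?thesis .
qed

text \<open>\<open>ffact (real k) j\<close> equals \<open>fact j\<close> times
  \<open>k choose j\<close>. The case split is needed because for \<open>k < j\<close> the truncated
  \<open>k - j\<close> would give 1 instead of 0.\<close>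

lemma ffact_of_nat_div_fact:
  "ffact (real k) j / fact k = (if k < j then 0 else 1 / fact (k - j))"
proof -
  have "ffact (real k) j = fact j * (real k gchoose j)"
    by (simp add: ffact_def gbinomial_prod_rev lessThan_atLeast0)
  also have "\<dots> = fact j * real (k choose j)"
    by (simp add: binomial_gbinomial)
  finally show ?thesis
    by (auto simp: binomial_fact)
qed

lemma summable_ffact_div_fact: "summable (\<lambda>k. \<bar>ffact (real k) j / fact k\<bar>)"
proof -
  \<comment> \<open>Shifted past its \<open>j\<close> vanishing terms, the series is the exponential
    series at 1.\<close>
  have "summable (\<lambda>k. \<bar>ffact (real (k + j)) j / fact (k + j)\<bar>)"
    using summable_exp[of "1 :: real"] by (simp only: ffact_of_nat_div_fact) (simp add: field_simps)
  then show ?thesis by (rule summable_iff_shift[THEN iffD1])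
qed

lemma sum_ffact_div_fact_alternating:
  "(\<Sum>k\<le>N. ffact (real k) j / fact k * ((-1) ^ (N - k) / fact (N - k))) = (if N = j then 1 else 0)"
proof (cases "N < j")
  case True
  then show ?thesis by (auto simp: ffact_of_nat_div_fact intro!: sum.neutral)
next
  case False
  then obtain d where N: "N = d + j" by (metis add.commute le_Suc_ex not_less)
  have "(\<Sum>k\<le>N. ffact (real k) j / fact k * ((-1) ^ (N - k) / fact (N - k)))
      = (\<Sum>k\<in>{0 + j..d + j}. ffact (real k) j / fact k * ((-1) ^ (N - k) / fact (N - k)))"
    by (rule sum.mono_neutral_right) (auto simp: ffact_of_nat_div_fact N)
  also have "\<dots> = (\<Sum>i\<in>{0..d}. 1 / fact i * ((-1) ^ (d - i) / fact (d - i)))"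
    by (simp only: sum.shift_bounds_cl_nat_ivl ffact_of_nat_div_fact) (simp add: N)
  \<comment> \<open>This is the coefficient of \<open>t ^ d\<close> in
    \<open>exp t * exp (- t)\<close>, which is zero unless \<open>d = 0\<close>, that is,
    \<open>N = j\<close>.\<close>
  also have "\<dots> = (1 + - 1 :: real) ^ d /\<^sub>R fact d"
    by (subst exp_series_add_commuting) (simp_all add: atLeast0AtMost field_simps)
  finally show ?thesis by (simp add: N power_0_left)
qed

text \<open>The weight depends only on \<open>m + k\<close> and is bounded, so the double family is
  dominated by a product of two absolutely convergent series. Its sum over the quadrant may then be
  taken along diagonals or along rows.\<close>

lemma weighted_Cauchy_product_sums:
  fixes a b w :: "nat \<Rightarrow> real"
  assumes a: "summable (\<lambda>k. \<bar>a k\<bar>)" and b: "summable (\<lambda>m. \<bar>b m\<bar>)"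
    and w: "\<And>n. \<bar>w n\<bar> \<le> C"
    and diag: "((\<lambda>N. w N * (\<Sum>i\<le>N. a i * b (N - i))) has_sum S) UNIV"
  shows "summable (\<lambda>m. b m * w (m + k))" (is ?inner)
    and "(\<lambda>k. a k * (\<Sum>m. b m * w (m + k))) sums S" (is ?outer)
proof -
  have abs: "summable (\<lambda>m. norm (b m * w (m + k)))" for k
  proof (rule summable_comparison_test')
    show "summable (\<lambda>m. \<bar>b m\<bar> * C)" using b by (rule summable_mult2)
    show "norm (norm (b m * w (m + k))) \<le> \<bar>b m\<bar> * C" for m
      using w[of "m + k"] by (simp add: abs_mult mult_left_mono)
  qed
  then show ?inner by (rule summable_norm_cancel)
  define f where "f = (\<lambda>(k, m). a k * (b m * w (m + k)))"
  have "(\<lambda>(k, m). \<bar>a k\<bar> * (\<bar>b m\<bar> * C)) summable_on UNIV \<times> UNIV"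
  proof (rule summable_on_SigmaI)
    have C: "C \<ge> 0" using w[of 0] by linarith
    show "((\<lambda>m. case (k, m) of (k, m) \<Rightarrow> \<bar>a k\<bar> * (\<bar>b m\<bar> * C)) has_sum
        \<bar>a k\<bar> * ((\<Sum>m. \<bar>b m\<bar>) * C)) UNIV" for k
      unfolding prod.case
      by (rule sums_nonneg_imp_has_sum) (use b C in \<open>auto intro!: sums_mult sums_mult2 summable_sums\<close>)
    show "(\<lambda>k. \<bar>a k\<bar> * ((\<Sum>m. \<bar>b m\<bar>) * C)) summable_on UNIV"
      using a b C by (subst summable_on_UNIV_nonneg_real_iff)
        (auto intro!: summable_mult2 mult_nonneg_nonneg suminf_nonneg)
    show "0 \<le> (case (k, m) of (k, m) \<Rightarrow> \<bar>a k\<bar> * (\<bar>b m\<bar> * C))" for k m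
      using C by simp
  qed
  then have "f abs_summable_on UNIV \<times> UNIV"
    by (rule summable_on_comparison_test)
      (auto simp: f_def abs_mult intro!: mult_left_mono w)
  then have f: "f summable_on UNIV \<times> UNIV"
    by (rule abs_summable_summable)
  \<comment> \<open>The pair \<open>(N, i)\<close> names the \<open>i\<close>-th point of the
    \<open>N\<close>-th diagonal. The bound \<open>i \<le> N\<close> keeps \<open>N - i\<close> from
    truncating.\<close>
  have bij: "bij_betw (\<lambda>(N, i). (i, N - i)) (Sigma UNIV (\<lambda>N::nat. {..N})) (UNIV \<times> UNIV)"
    by (rule bij_betwI[of _ _ _ "\<lambda>(i, m). (i + m, i)"]) auto
  have "((\<lambda>p. f ((\<lambda>(N, i). (i, N - i)) p)) has_sum S) (Sigma UNIV (\<lambda>N. {..N}))"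
  proof (rule has_sum_SigmaI)
    show "((\<lambda>N. w N * (\<Sum>i\<le>N. a i * b (N - i))) has_sum S) UNIV" by (rule diag)
  next
    fix N
    have "((\<lambda>i. f (i, N - i)) has_sum (\<Sum>i\<le>N. f (i, N - i))) {..N}"
      by (rule has_sum_finite) simp
    then show "((\<lambda>i. f ((\<lambda>(N, i). (i, N - i)) (N, i))) has_sum
        w N * (\<Sum>i\<le>N. a i * b (N - i))) {..N}"
      by (simp add: f_def sum_distrib_left mult_ac)
  qed (use f in \<open>simp only: summable_on_reindex_bij_betw[OF bij]\<close>)
  then have "(f has_sum S) (UNIV \<times> UNIV)"
    by (simp only: has_sum_reindex_bij_betw[OF bij])
  \<comment> \<open>The same unordered sum is now evaluated row by row, with \<open>m\<close> as the
    inner index.\<close>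
  then have "((\<lambda>k. a k * (\<Sum>m. b m * w (m + k))) has_sum S) UNIV"
  proof (rule has_sum_SigmaD)
    fix k
    have "((\<lambda>m. b m * w (m + k)) has_sum (\<Sum>m. b m * w (m + k))) UNIV"
      using abs by (intro norm_summable_imp_has_sum summable_sums) (auto intro: summable_norm_cancel)
    then show "((\<lambda>m. f (k, m)) has_sum a k * (\<Sum>m. b m * w (m + k))) UNIV"
      by (simp add: f_def has_sum_cmult_right)
  qed
  then show ?outer by (rule has_sum_imp_sums)
qed

lemma ffact_double_series:
  fixes p j :: nat
  defines "t \<equiv> \<lambda>k m. (-1) ^ m / (fact m * real ((m + k + p) choose p))"
  shows "summable (t k)"
    and "(\<lambda>k. ffact (real k) j / fact k * (\<Sum>m. t k m)) sums (1 / real ((p + j) choose j))"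
proof -
  define w where "w = (\<lambda>N. 1 / real ((N + p) choose p))"
  have t: "t k = (\<lambda>m. (-1) ^ m / fact m * w (m + k))" for k
    by (simp add: t_def w_def)
  have b: "summable (\<lambda>m. \<bar>(-1) ^ m / fact m :: real\<bar>)"
    using summable_exp[of "1 :: real"] by (simp add: abs_divide power_abs field_simps)
  \<comment> \<open>A positive binomial coefficient is at least 1, so the bound \<open>C\<close> can
    be 1.\<close>
  have w: "\<bar>w N\<bar> \<le> 1" for N
    using zero_less_binomial[of p "N + p"] unfolding w_def by (simp add: divide_le_eq Suc_le_eq)
  \<comment> \<open>Only the diagonal \<open>N = j\<close> survives, so the whole sum is the single
    weight \<open>w j\<close>.\<close>
  have "((\<lambda>N. w N * (if N = j then 1 else 0)) has_sum w j) UNIV"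
    using has_sum_finite[of "{j}" w]
    by (subst has_sum_cong_neutral[where T = "{j}" and g = w]) auto
  then have "((\<lambda>N. w N * (\<Sum>i\<le>N. ffact (real i) j / fact i * ((-1) ^ (N - i) / fact (N - i))))
      has_sum w j) UNIV"
    by (simp only: sum_ffact_div_fact_alternating)
  note * = weighted_Cauchy_product_sums[OF summable_ffact_div_fact b w this]
  show "summable (t k)" unfolding t by (rule *(1))
  have "(j + p) choose p = (p + j) choose j"
    using binomial_symmetric[of p "j + p"] by (simp add: add.commute)
  then have "w j = 1 / real ((p + j) choose j)" by (simp add: w_def)
  then show "(\<lambda>k. ffact (real k) j / fact k * (\<Sum>m. t k m)) sums (1 / real ((p + j) choose j))"
    using *(2) unfolding t by simp
qed

theorem theorem15:
  fixes l x :: real and n p :: nat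
  shows "(\<forall>k. summable (\<lambda>m. degen_ffact l (x + real k) n / fact k *
              ((-1) ^ m / (fact m * real ((m + k + p) choose p))))) \<and>
         (\<lambda>k. \<Sum>m. degen_ffact l (x + real k) n / fact k *
              ((-1) ^ m / (fact m * real ((m + k + p) choose p))))
         sums (\<Sum>m\<le>n. \<Sum>k\<le>m. real (n choose m) / real ((p + k) choose k) *
              degen_Stirling2 l m k * degen_ffact l x (n - m))"
proof (intro conjI allI)
  let ?t = "\<lambda>k m. (-1) ^ m / (fact m * real ((m + k + p) choose p)) :: real"
  let ?c = "\<lambda>q j. real (n choose q) * degen_Stirling2 l q j * degen_ffact l x (n - q)"
  show "summable (\<lambda>m. degen_ffact l (x + real k) n / fact k * ?t k m)" for k
    by (intro summable_mult ffact_double_series)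
  have "(\<Sum>m. degen_ffact l (x + real k) n / fact k * ?t k m)
      = (\<Sum>q\<le>n. \<Sum>j\<le>q. ?c q j * (ffact (real k) j / fact k * (\<Sum>m. ?t k m)))" for k
  proof -
    \<comment> \<open>The binomial theorem separates \<open>x\<close> from \<open>k\<close>, and the
      Stirling expansion then turns \<open>degen_ffact l k q\<close> into falling factorials of
      \<open>k\<close>.\<close>
    have "degen_ffact l (x + real k) n / fact k
        = (\<Sum>q\<le>n. \<Sum>j\<le>q. ?c q j * (ffact (real k) j / fact k))"
      by (simp add: degen_ffact_add degen_Stirling2_expansion[of l "real k"] sum_divide_distrib
          sum_distrib_left sum_distrib_right mult_ac)
    then show ?thesis
      by (subst suminf_mult[OF ffact_double_series(1)]) (simp only: sum_distrib_right mult.assoc)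
  qed
  moreover have "(\<lambda>k. \<Sum>q\<le>n. \<Sum>j\<le>q. ?c q j * (ffact (real k) j / fact k * (\<Sum>m. ?t k m)))
      sums (\<Sum>q\<le>n. \<Sum>j\<le>q. ?c q j * (1 / real ((p + j) choose j)))"
    by (intro sums_sum sums_mult ffact_double_series)
  ultimately show "(\<lambda>k. \<Sum>m. degen_ffact l (x + real k) n / fact k * ?t k m)
      sums (\<Sum>m\<le>n. \<Sum>k\<le>m. real (n choose m) / real ((p + k) choose k) *
              degen_Stirling2 l m k * degen_ffact l x (n - m))"
    by (simp add: mult_ac)
qed

end
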